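(* Let $n\ge 3$ be an integer and let $R_n^3=\langle (n-1)^3,n^3,(n+1)^3\rangle$. Then $R_n^3$ is symmetric if and only if $n=3$.
   Context: For positive integers $d_1,d_2,d_3$ with $\gcd(d_1,d_2,d_3)=1$, $\langle d_1,d_2,d_3\rangle=\{x_1d_1+x_2d_2+x_3d_3 : x_i\in\mathbb{Z}_{\ge 0}\}$ is the numerical semigroup generated by $d_1,d_2,d_3$ (the generators need not be a minimal generating set). The Frobenius number $F(S)$ of a numerical semigroup $S$ is the largest integer not in $S$. A numerical semigroup $S$ is symmetric if for every integer $s$ exactly one of $s$ and $F(S)-s$ belongs to $S$. *)

theory Defs
  imports Complex_Main
begin

definition semigroup3 :: "int \<Rightarrow> int \<Rightarrow> int \<Rightarrow> int set" where
  "semigroup3 d1 d2 d3 =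
     {x1 * d1 + x2 * d2 + x3 * d3 | x1 x2 x3 :: int. 0 \<le> x1 \<and> 0 \<le> x2 \<and> 0 \<le> x3}"

text \<open>
  Numerical semigroups are sets of integers (not of naturals), because the Frobenius
  number of the full semigroup of nonnegative integers is -1 and symmetry ranges over all
  integers. The Frobenius number is meaningful only if the complement of the set has a
  largest element; this holds for three positive generators with greatest common divisor 1.
\<close>

definition frobenius_number :: "int set \<Rightarrow> int" where
  "frobenius_number S = (GREATEST s. s \<notin> S)"

definition symmetric_semigroup :: "int set \<Rightarrow> bool" where
  "symmetric_semigroup S \<longleftrightarrow>
     (\<forall>s :: int. (s \<in> S) \<noteq> (frobenius_number S - s \<in> S))"

end

theory Submission
  imports Defs
begin

text \<open>
  Let \<open>S = \<langle>a, b, c\<rangle>\<close> be symmetric with Frobenius number \<open>F\<close>, and let \<open>A\<close> be its Apery set with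
  respect to \<open>a\<close>. By symmetry every element of \<open>A\<close> is a summand in \<open>S\<close> of \<open>F + a = y b + z c\<close>.
  If this representation is unique (as it is when \<open>b, c\<close> are coprime and \<open>a \<le> c\<close>),
  \<open>A\<close> is the rectangle of all \<open>p b + q c\<close> with \<open>p \<le> y\<close> and \<open>q \<le> z\<close>.
  Reducing \<open>(y + 1) b\<close> and \<open>(z + 1) c\<close> modulo \<open>a\<close> into the rectangle shows that one of
  them is a multiple of \<open>a\<close>, so that the multiples of \<open>b\<close> (or of \<open>c\<close>) in \<open>A\<close> meet every residue
  class that they can meet; hence \<open>gcd a b * c \<in> \<langle>a, b\<rangle>\<close> or \<open>gcd a c * b \<in> \<langle>a, c\<rangle>\<close>. For the
  cubes of \<open>n - 1, n, n + 1\<close> with \<open>n \<ge> 4\<close> both memberships fail.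
\<close>

section \<open>Three-generated semigroups and congruences\<close>

lemma semigroup3_iff:
  "s \<in> semigroup3 a b c \<longleftrightarrow> (\<exists>x y z. 0 \<le> x \<and> 0 \<le> y \<and> 0 \<le> z \<and> s = x * a + y * b + z * c)"
  unfolding semigroup3_def by blast

lemma semigroup3I:
  "0 \<le> x \<Longrightarrow> 0 \<le> y \<Longrightarrow> 0 \<le> z \<Longrightarrow> s = x * a + y * b + z * c \<Longrightarrow> s \<in> semigroup3 a b c"
  unfolding semigroup3_iff by blast

lemma semigroup3_add:
  assumes "s \<in> semigroup3 a b c" "t \<in> semigroup3 a b c"
  shows "s + t \<in> semigroup3 a b c"
proof -
  obtain x y z where s: "0 \<le> x" "0 \<le> y" "0 \<le> z" "s = x * a + y * b + z * c"
    using assms(1) unfolding semigroup3_iff by blast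
  obtain x' y' z' where t: "0 \<le> x'" "0 \<le> y'" "0 \<le> z'" "t = x' * a + y' * b + z' * c"
    using assms(2) unfolding semigroup3_iff by blast
  show ?thesis
    by (rule semigroup3I[of "x + x'" "y + y'" "z + z'"]) (use s t in \<open>auto simp: algebra_simps\<close>)
qed

lemma semigroup3_nonneg:
  assumes "0 < a" "0 < b" "0 < c" "s \<in> semigroup3 a b c"
  shows "0 \<le> s"
  using assms unfolding semigroup3_iff by auto

text \<open>Bezout gives a multiple of \<open>c\<close> congruent to \<open>m\<close> modulo
  \<open>a\<close>; since \<open>a\<close> divides \<open>T * c\<close>, its coefficient may be
  reduced modulo \<open>T\<close>.\<close>

lemma bounded_multiple_cong:
  fixes a c m T :: int
  assumes "gcd a c dvd m" "0 < T" "a dvd T * c"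
  shows "\<exists>t. 0 \<le> t \<and> t < T \<and> a dvd m - t * c"
proof -
  obtain u v where uv: "u * a + v * c = gcd a c"
    using bezout_int by blast
  obtain k where k: "m = gcd a c * k"
    using assms(1) by blast
  define q where "q = (v * k) div T"
  have "m - (v * k) mod T * c = (u * k) * a + q * (T * c)"
  proof -
    have "(v * k) mod T = v * k - T * q"
      unfolding q_def by (simp add: minus_mult_div_eq_mod)
    then show ?thesis
      unfolding k uv[symmetric] by algebra
  qed
  then have "a dvd m - (v * k) mod T * c"
    using assms(3) by simp
  then show ?thesis
    using assms(2) pos_mod_bound pos_mod_sign by blast
qed

section \<open>Apery sets\<close>

definition apery_set :: "int \<Rightarrow> int \<Rightarrow> int \<Rightarrow> int set" where
  "apery_set a b c = {s \<in> semigroup3 a b c. s - a \<notin> semigroup3 a b c}"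

lemma apery_set_summand:
  assumes "s + t \<in> apery_set a b c" "s \<in> semigroup3 a b c" "t \<in> semigroup3 a b c"
  shows "s \<in> apery_set a b c"
proof -
  have "s - a \<notin> semigroup3 a b c"
  proof
    assume "s - a \<in> semigroup3 a b c"
    from semigroup3_add[OF this assms(3)] have "s + t - a \<in> semigroup3 a b c"
      by (simp add: algebra_simps)
    then show False
      using assms(1) by (simp add: apery_set_def)
  qed
  then show ?thesis
    using assms(2) by (simp add: apery_set_def)
qed

text \<open>Were \<open>k\<close> negative, \<open>t - a\<close> would be \<open>s\<close> plus
  copies of \<open>a\<close>, hence in the semigroup.\<close>

lemma apery_set_least:
  assumes "0 < a" "t \<in> apery_set a b c" "s \<in> semigroup3 a b c" "a dvd s - t"
  shows "\<exists>k\<ge>0. s = k * a + t"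
proof -
  obtain k where k: "s - t = a * k"
    using assms(4) by blast
  have "0 \<le> k"
  proof (rule ccontr)
    assume "\<not> 0 \<le> k"
    then have "(- k - 1) * a \<in> semigroup3 a b c"
      by (intro semigroup3I[of "- k - 1" 0 0]) auto
    from semigroup3_add[OF assms(3) this] have "t - a \<in> semigroup3 a b c"
      using k by (simp add: algebra_simps)
    then show False
      using assms(2) by (simp add: apery_set_def)
  qed
  then show ?thesis
    using k by (intro exI[of _ k]) (simp add: algebra_simps)
qed

lemma apery_set_coeff_zero:
  assumes "x * a + y * b + z * c \<in> apery_set a b c" "0 \<le> x" "0 \<le> y" "0 \<le> z"
  shows "x = 0"
proof (rule ccontr)
  assume "x \<noteq> 0"
  then have "x * a + y * b + z * c - a \<in> semigroup3 a b c"
    using assms by (intro semigroup3I[of "x - 1" y z]) (auto simp: algebra_simps)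
  then show False
    using assms(1) by (simp add: apery_set_def)
qed

lemma apery_set_decomposition:
  assumes "0 < a" "0 < b" "0 < c" "s \<in> semigroup3 a b c"
  shows "\<exists>k\<ge>0. \<exists>t \<in> apery_set a b c. s = k * a + t"
  using assms(4)
proof (induction "nat s" arbitrary: s rule: less_induct)
  case less
  show ?case
  proof (cases "s - a \<in> semigroup3 a b c")
    case True
    then have "nat (s - a) < nat s"
      using semigroup3_nonneg[OF assms(1-3) True] assms(1) by auto
    from less.hyps[OF this True] obtain k t where
      "k \<ge> 0" "t \<in> apery_set a b c" "s - a = k * a + t" by blast
    then show ?thesis
      by (intro exI[of _ "k + 1"] conjI bexI[of _ t]) (auto simp: algebra_simps)
  next
    case False
    then show ?thesis
      using less.prems by (intro exI[of _ 0] conjI bexI[of _ s]) (auto simp: apery_set_def)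
  qed
qed

text \<open>If a \<open>b\<close>-coefficient reached \<open>a\<close>, then \<open>a\<close> copies
  of \<open>b\<close> could be traded for \<open>b\<close> copies of \<open>a\<close>, which an
  Apery element forbids. So \<open>y\<close> and \<open>y'\<close> differ by less than
  \<open>c\<close>, while coprimality makes \<open>c\<close> divide their difference.\<close>

lemma apery_set_max_unique:
  assumes "0 < a" "0 < b" "a \<le> c" "coprime b c"
    and "y * b + z * c \<in> apery_set a b c" "0 \<le> y" "0 \<le> z"
    and "y * b + z * c = y' * b + z' * c" "0 \<le> y'" "0 \<le> z'"
  shows "y = y' \<and> z = z'"
proof -
  have small: "u < a" if "u * b + v * c \<in> apery_set a b c" "0 \<le> v" for u v
  proof (rule ccontr)
    assume "\<not> u < a"
    then have "0 \<le> (u - a) * b" "0 \<le> u - a" using assms by auto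
    then have "u * b + v * c - a \<in> semigroup3 a b c"
      using assms that by (intro semigroup3I[of "b - 1" "u - a" v]) (auto simp: algebra_simps)
    then show False
      using that by (simp add: apery_set_def)
  qed
  have lt: "y < a" "y' < a"
    using small assms by metis+
  have eq: "(y - y') * b = (z' - z) * c"
    using assms(8) by (simp add: algebra_simps)
  then have "c dvd (y - y') * b" by simp
  then have "c dvd y - y'"
    using assms(4) by (simp add: coprime_dvd_mult_left_iff coprime_commute)
  moreover have "\<bar>y - y'\<bar> < c"
    using lt assms by auto
  ultimately have "y = y'"
    using dvd_imp_le_int[of "y - y'" c] by fastforce
  then show ?thesis
    using eq assms by auto
qed

section \<open>Symmetry forces a gluing\<close>

text \<open>With \<open>g = gcd a b\<close>, the first alternative says that \<open>c\<close> lies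
  in the semigroup generated by \<open>a / g\<close> and \<open>b / g\<close>, the membership
  required in a gluing.\<close>

lemma symmetric_semigroup3_imp_gluing:
  assumes pos: "0 < a" "0 < b" and ac: "a \<le> c" and cop: "coprime b c"
    and sym: "symmetric_semigroup (semigroup3 a b c)"
  shows "(\<exists>i j. 0 \<le> i \<and> 0 \<le> j \<and> gcd a b * c = i * a + j * b) \<or>
         (\<exists>i j. 0 \<le> i \<and> 0 \<le> j \<and> gcd a c * b = i * a + j * c)"
proof -
  have c: "0 < c" using pos ac by simp
  let ?S = "semigroup3 a b c" and ?A = "apery_set a b c"
  \<comment> \<open>For an Apery element \<open>s\<close>, reflecting the gap \<open>s - a\<close>
    in the Frobenius number yields \<open>w - s\<close>.\<close>
  define w where "w = frobenius_number ?S + a"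
  then have frob: "frobenius_number ?S = w - a" by simp
  have symS: "s \<in> ?S \<longleftrightarrow> w - a - s \<notin> ?S" for s
    using sym unfolding symmetric_semigroup_def frob by blast
  have zero: "0 \<in> ?S"
    by (rule semigroup3I[of 0 0 0]) auto
  have neg: "s \<notin> ?S" if "s < 0" for s
    using semigroup3_nonneg[OF pos c] that by force
  have compl: "w - s \<in> ?S" if "s \<in> ?A" for s
  proof -
    have "w - a - (s - a) \<in> ?S"
      using that symS[of "s - a"] unfolding apery_set_def by blast
    then show ?thesis by simp
  qed
  have zeroA: "0 \<in> ?A"
    using zero neg[of "- a"] pos by (simp add: apery_set_def)
  have wA: "w \<in> ?A"
    using compl[OF zeroA] symS[of 0] zero by (simp add: apery_set_def)
  obtain y z where yz: "0 \<le> y" "0 \<le> z" and w: "w = y * b + z * c"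
  proof -
    obtain x y z where h: "0 \<le> x" "0 \<le> y" "0 \<le> z" "w = x * a + y * b + z * c"
      using wA unfolding apery_set_def semigroup3_iff by auto
    then have "x = 0"
      using wA apery_set_coeff_zero by metis
    then show ?thesis using that h by simp
  qed
  have unique: "y = y' \<and> z = z'" if "w = y' * b + z' * c" "0 \<le> y'" "0 \<le> z'" for y' z'
    using apery_set_max_unique[OF pos ac cop _ yz _ that(2,3)] wA that(1) w by simp
  have rect_imp: "p * b + q * c \<in> ?A" if "0 \<le> p" "p \<le> y" "0 \<le> q" "q \<le> z" for p q
  proof (rule apery_set_summand)
    show "p * b + q * c \<in> ?S"
      using that by (intro semigroup3I[of 0 p q]) auto
    show "(y - p) * b + (z - q) * c \<in> ?S"
      using that by (intro semigroup3I[of 0 "y - p" "z - q"]) auto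
    show "p * b + q * c + ((y - p) * b + (z - q) * c) \<in> ?A"
      using wA w by (simp add: algebra_simps)
  qed
  have imp_rect: "\<exists>p q. 0 \<le> p \<and> p \<le> y \<and> 0 \<le> q \<and> q \<le> z \<and> s = p * b + q * c" if sA: "s \<in> ?A" for s
  proof -
    obtain x p q where s: "0 \<le> x" "0 \<le> p" "0 \<le> q" "s = x * a + p * b + q * c"
      using sA unfolding apery_set_def semigroup3_iff by auto
    obtain x' p' q' where s': "0 \<le> x'" "0 \<le> p'" "0 \<le> q'" "w - s = x' * a + p' * b + q' * c"
      using compl[OF sA] unfolding semigroup3_iff by auto
    \<comment> \<open>Representations of \<open>s\<close> and \<open>w - s\<close> add up to the
      unique one of \<open>w\<close>.\<close>
    have weq: "w = (x + x') * a + (p + p') * b + (q + q') * c"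
      using s(4) s'(4) by (simp add: algebra_simps)
    then have "x + x' = 0"
      using wA s s' apery_set_coeff_zero[of "x + x'" a "p + p'" b "q + q'" c] by simp
    then have "x = 0" "x' = 0" using s s' by auto
    then have "y = p + p' \<and> z = q + q'"
      using unique[of "p + p'" "q + q'"] weq s s' by simp
    then show ?thesis
      using s s' \<open>x = 0\<close> by (intro exI[of _ p] exI[of _ q]) auto
  qed
  have rect_cong_zero: "p = 0 \<and> q = 0"
    if "0 \<le> p" "p \<le> y" "0 \<le> q" "q \<le> z" "0 \<le> i" "p * b + q * c = i * a" for p q i
  proof -
    have "i = 0"
      using rect_imp[OF that(1-4)] that(5,6) apery_set_coeff_zero[of i a 0 b 0 c] by simp
    then have "p * b + q * c = 0" using that by simp
    moreover have "0 \<le> p * b" "0 \<le> q * c" using that pos c by auto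
    ultimately have "p * b = 0" "q * c = 0" by linarith+
    then show ?thesis using pos c by simp
  qed
  have edge_b: "\<exists>i q. 0 \<le> i \<and> 0 \<le> q \<and> q \<le> z \<and> (y + 1) * b = i * a + q * c"
  proof -
    have "(y + 1) * b \<in> ?S"
      using yz by (intro semigroup3I[of 0 "y + 1" 0]) auto
    then obtain i p q where h: "0 \<le> i" "0 \<le> p" "p \<le> y" "0 \<le> q" "q \<le> z"
      "(y + 1) * b = i * a + (p * b + q * c)"
      using apery_set_decomposition[OF pos c] imp_rect by metis
    \<comment> \<open>Otherwise cancelling \<open>p * b\<close> leaves a rectangle element, so
      \<open>i = 0\<close>; trading \<open>q * c\<close> for \<open>(y + 1 - p) * b\<close> inside
      \<open>w\<close> then gives \<open>w\<close> a second representation.\<close>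
    have "p = 0"
    proof (rule ccontr)
      assume p: "p \<noteq> 0"
      have eq: "(y + 1 - p) * b = i * a + q * c"
        using h(6) by (simp add: algebra_simps)
      have "(y + 1 - p) * b + 0 * c \<in> ?A"
        using h p yz by (intro rect_imp) auto
      then have "i = 0"
        using eq h apery_set_coeff_zero[of i a 0 b q c] by simp
      then have "w = (y + (y + 1 - p)) * b + (z - q) * c"
        using eq w by (simp add: algebra_simps)
      then show False
        using unique[of "y + (y + 1 - p)" "z - q"] h yz by auto
    qed
    then show ?thesis using h by auto
  qed
  have edge_c: "\<exists>j p. 0 \<le> j \<and> 0 \<le> p \<and> p \<le> y \<and> (z + 1) * c = j * a + p * b"
  proof -
    have "(z + 1) * c \<in> ?S"
      using yz by (intro semigroup3I[of 0 0 "z + 1"]) auto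
    then obtain i p q where h: "0 \<le> i" "0 \<le> p" "p \<le> y" "0 \<le> q" "q \<le> z"
      "(z + 1) * c = i * a + (p * b + q * c)"
      using apery_set_decomposition[OF pos c] imp_rect by metis
    have "q = 0"
    proof (rule ccontr)
      assume q: "q \<noteq> 0"
      have eq: "(z + 1 - q) * c = i * a + p * b"
        using h(6) by (simp add: algebra_simps)
      have "0 * b + (z + 1 - q) * c \<in> ?A"
        using h q yz by (intro rect_imp) auto
      then have "i = 0"
        using eq h apery_set_coeff_zero[of i a p b 0 c] by simp
      then have "w = (y - p) * b + (z + (z + 1 - q)) * c"
        using eq w by (simp add: algebra_simps)
      then show False
        using unique[of "y - p" "z + (z + 1 - q)"] h yz by auto
    qed
    then show ?thesis using h by auto
  qed
  obtain i q where iq: "0 \<le> i" "0 \<le> q" "q \<le> z" "(y + 1) * b = i * a + q * c"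
    using edge_b by blast
  obtain j p where jp: "0 \<le> j" "0 \<le> p" "p \<le> y" "(z + 1) * c = j * a + p * b"
    using edge_c by blast
  \<comment> \<open>If both were nonzero, the sum of the two edge relations would be a multiple of
    \<open>a\<close> in the rectangle away from the origin.\<close>
  have "q = 0 \<or> p = 0"
  proof (rule ccontr)
    assume nz: "\<not> (q = 0 \<or> p = 0)"
    have "(y + 1 - p) * b + (z + 1 - q) * c = (i + j) * a"
      using iq(4) jp(4) by (simp add: algebra_simps)
    then have "y + 1 - p = 0"
      using rect_cong_zero[of "y + 1 - p" "z + 1 - q" "i + j"] nz iq jp by auto
    then show False using jp by simp
  qed
  then show ?thesis
  proof
    assume "q = 0"
    then have "a dvd (y + 1) * b" using iq by simp
    \<comment> \<open>Since \<open>t \<le> y\<close>, \<open>t * b\<close> is on an edge of the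
      rectangle, hence the least element of the class of \<open>gcd a b * c\<close>.\<close>
    then obtain t where t: "0 \<le> t" "t < y + 1" "a dvd gcd a b * c - t * b"
      using bounded_multiple_cong[of a b "gcd a b * c" "y + 1"] yz by auto
    have "t * b \<in> ?A"
      using rect_imp[of t 0] t yz by simp
    moreover have "gcd a b * c \<in> ?S"
      by (rule semigroup3I[of 0 0 "gcd a b"]) auto
    ultimately show ?thesis
      using apery_set_least[OF pos(1) _ _ t(3)] t(1) by blast
  next
    assume "p = 0"
    then have "a dvd (z + 1) * c" using jp by simp
    then obtain t where t: "0 \<le> t" "t < z + 1" "a dvd gcd a c * b - t * c"
      using bounded_multiple_cong[of a c "gcd a c * b" "z + 1"] yz by auto
    have "t * c \<in> ?A"
      using rect_imp[of 0 t] t yz by simp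
    moreover have "gcd a c * b \<in> ?S"
      by (rule semigroup3I[of 0 "gcd a c" 0]) auto
    ultimately show ?thesis
      using apery_set_least[OF pos(1) _ _ t(3)] t(1) by blast
  qed
qed

section \<open>The case \<open>n = 3\<close>\<close>

text \<open>As 64 is a multiple of 8, this is the semigroup of 8 and 27. In coordinates
  \<open>8 * k + 27 * r\<close> with \<open>0 \<le> r < 8\<close>, reflection sends
  \<open>(k, r)\<close> to \<open>(-1 - k, 7 - r)\<close>.\<close>

lemma symmetric_semigroup3_8_27_64: "symmetric_semigroup (semigroup3 8 27 64)"
proof -
  have mem: "8 * k + 27 * r \<in> semigroup3 8 27 64 \<longleftrightarrow> 0 \<le> k" if r: "0 \<le> r" "r < 8" for k r
  proof
    assume "8 * k + 27 * r \<in> semigroup3 8 27 64"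
    then obtain x y z where h: "0 \<le> x" "0 \<le> y" "0 \<le> z" "8 * k + 27 * r = x * 8 + y * 27 + z * 64"
      unfolding semigroup3_iff by blast
    \<comment> \<open>The coefficients come from \<open>3 * 27 - 10 * 8 = 1\<close>.\<close>
    define t where "t = 3 * (k - x - 8 * z) - 10 * (y - r)"
    have t: "y - r = 8 * t"
      using h(4) unfolding t_def by (simp add: algebra_simps)
    then have "0 \<le> t" using h(2) r by linarith
    then show "0 \<le> k" using h t by linarith
  next
    assume "0 \<le> k"
    then show "8 * k + 27 * r \<in> semigroup3 8 27 64"
      using r by (intro semigroup3I[of k r 0]) auto
  qed
  have repr: "\<exists>k r. 0 \<le> r \<and> r < 8 \<and> s = 8 * k + 27 * r" for s :: int
  proof (intro exI conjI)
    \<comment> \<open>3 is the inverse of 27 modulo 8.\<close>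
    define q where "q = (3 * s) div 8"
    define r where "r = (3 * s) mod 8"
    show "0 \<le> r" "r < 8" unfolding r_def by simp_all
    have "3 * s = 8 * q + r" unfolding q_def r_def by simp
    then show "s = 8 * (3 * q - s - 3 * r) + 27 * r" by simp
  qed
  have frob: "frobenius_number (semigroup3 8 27 64) = 181"
    unfolding frobenius_number_def
  proof (rule Greatest_equality)
    \<comment> \<open>181 has coordinates \<open>r = 7\<close> and \<open>k = -1\<close>.\<close>
    show "181 \<notin> semigroup3 8 27 64" using mem[of 7 "- 1"] by simp
    show "s \<le> 181" if "s \<notin> semigroup3 8 27 64" for s
    proof -
      obtain k r where kr: "0 \<le> r" "r < 8" "s = 8 * k + 27 * r" using repr by blast
      then have "k < 0" using mem that by force
      then show ?thesis using kr by linarith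
    qed
  qed
  have "(s \<in> semigroup3 8 27 64) \<noteq> (181 - s \<in> semigroup3 8 27 64)" for s
  proof -
    obtain k r where kr: "0 \<le> r" "r < 8" "s = 8 * k + 27 * r" using repr by blast
    then have "181 - s = 8 * (- 1 - k) + 27 * (7 - r)" by simp
    then have "181 - s \<in> semigroup3 8 27 64 \<longleftrightarrow> 0 \<le> - 1 - k"
      by (simp only:, intro mem) (use kr in auto)
    moreover have "s \<in> semigroup3 8 27 64 \<longleftrightarrow> 0 \<le> k"
      unfolding kr(3) using kr by (intro mem)
    ultimately show ?thesis by linarith
  qed
  then show ?thesis
    unfolding symmetric_semigroup_def frob by blast
qed

section \<open>Cubes outside two-generated semigroups\<close>

text \<open>Size leaves \<open>j\<close> equal to 0 or 1. Modulo \<open>n - 1\<close> the equation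
  then makes \<open>n - 1\<close> divide 8 or 7, leaving six values of \<open>n\<close> to
  test.\<close>

lemma next_cube_not_combination:
  fixes n i j :: int
  assumes "4 \<le> n" "0 \<le> i" "0 \<le> j"
  shows "(n + 1) ^ 3 \<noteq> i * (n - 1) ^ 3 + j * n ^ 3"
proof
  assume eq: "(n + 1) ^ 3 = i * (n - 1) ^ 3 + j * n ^ 3"
  have "j < 2"
  proof (rule ccontr)
    assume "\<not> j < 2"
    then have "2 * n ^ 3 \<le> j * n ^ 3"
      using assms by (intro mult_right_mono) auto
    moreover have "0 \<le> i * (n - 1) ^ 3" using assms by simp
    moreover have "(n + 1) ^ 3 < 2 * n ^ 3"
    proof -
      have "4 * n ^ 2 \<le> n ^ 3" "4 * n \<le> n ^ 2"
        using assms by (auto simp: power2_eq_square power3_eq_cube intro!: mult_right_mono)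
      moreover have "(n + 1) ^ 3 = n ^ 3 + 3 * n ^ 2 + 3 * n + 1"
        by (simp add: power2_eq_square power3_eq_cube algebra_simps)
      ultimately show ?thesis using assms by linarith
    qed
    ultimately show False using eq by linarith
  qed
  then have j: "j = 0 \<or> j = 1" using assms by linarith
  have "n \<le> 9"
  proof -
    from j have "n - 1 dvd 8 \<or> n - 1 dvd 7"
    proof
      assume 1: "j = 0"
      have "8 = (n - 1) * (i * (n - 1) ^ 2 - (n ^ 2 + 4 * n + 7))"
        using eq 1 by (simp add: power2_eq_square power3_eq_cube algebra_simps)
      then show ?thesis by (metis dvd_triv_left)
    next
      assume 2: "j = 1"
      have "7 = (n - 1) * (i * (n - 1) ^ 2 - (3 * n + 6))"
        using eq 2 by (simp add: power2_eq_square power3_eq_cube algebra_simps)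
      then show ?thesis by (metis dvd_triv_left)
    qed
    then show ?thesis
      using zdvd_imp_le[of "n - 1" 8] zdvd_imp_le[of "n - 1" 7] by auto
  qed
  then have "n = 4 \<or> n = 5 \<or> n = 6 \<or> n = 7 \<or> n = 8 \<or> n = 9"
    using assms by linarith
  moreover have "(n - 1) ^ 3 dvd (n + 1) ^ 3 - j * n ^ 3"
    using eq by simp
  ultimately show False
    using j by (elim disjE) simp_all
qed

text \<open>Serves odd \<open>n = 2 * m + 1\<close>, where the cubes of \<open>n - 1\<close> and
  \<open>n + 1\<close> share the factor 8. Size bounds \<open>j\<close> by 7, and the equation
  modulo \<open>m ^ 3\<close> determines \<open>j\<close>.\<close>

lemma odd_cube_not_combination:
  fixes m i j :: int
  assumes "2 \<le> m" "0 \<le> i" "0 \<le> j"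
  shows "(2 * m + 1) ^ 3 \<noteq> i * m ^ 3 + j * (m + 1) ^ 3"
proof
  assume eq: "(2 * m + 1) ^ 3 = i * m ^ 3 + j * (m + 1) ^ 3"
  have "j < 8"
  proof (rule ccontr)
    assume "\<not> j < 8"
    then have "8 * (m + 1) ^ 3 \<le> j * (m + 1) ^ 3"
      using assms by (intro mult_right_mono) auto
    moreover have "0 \<le> i * m ^ 3" using assms by simp
    moreover have "(2 * m + 1) ^ 3 < (2 * (m + 1)) ^ 3"
      using assms by (intro power_strict_mono) auto
    ultimately show False
      using eq power_mult_distrib[of 2 "m + 1" 3] by simp
  qed
  \<comment> \<open>Multiply by \<open>1 - 3 m + 6 m\<^sup>2\<close>, the inverse of \<open>(m + 1)\<^sup>3\<close> modulo \<open>m\<^sup>3\<close>.\<close>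
  have "j - (1 + 3 * m) = m ^ 3 *
      (8 + 48 * m + 48 * m ^ 2 - i * (1 - 3 * m + 6 * m ^ 2) - j * (10 + 15 * m + 6 * m ^ 2))"
    using eq by algebra
  then have "m ^ 3 dvd j - (1 + 3 * m)" by (metis dvd_triv_left)
  moreover have "\<bar>j - (1 + 3 * m)\<bar> < m ^ 3"
  proof -
    have "2 * 2 * m \<le> m * m * m"
      using assms by (intro mult_mono) auto
    then show ?thesis
      using assms \<open>j < 8\<close> unfolding power3_eq_cube by linarith
  qed
  ultimately have "j = 1 + 3 * m"
    using dvd_imp_le_int[of "j - (1 + 3 * m)" "m ^ 3"] by fastforce
  \<comment> \<open>\<open>1 + 3 * m < 8\<close> leaves only \<open>m = 2\<close>, where
    \<open>7 * 3 ^ 3\<close> already exceeds \<open>5 ^ 3\<close>.\<close>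
  then have "m = 2" "j = 7"
    using assms \<open>j < 8\<close> by linarith+
  then show False
    using eq assms by simp
qed

text \<open>For even \<open>n\<close> the gcd is 1 and size forces \<open>j = 0\<close>, but
  \<open>n ^ 3\<close> is 1 modulo \<open>n - 1\<close>. For odd \<open>n\<close> the gcd is 8,
  which cancels.\<close>

lemma middle_cube_not_combination:
  fixes n i j :: int
  assumes "4 \<le> n" "0 \<le> i" "0 \<le> j"
  shows "gcd ((n - 1) ^ 3) ((n + 1) ^ 3) * n ^ 3 \<noteq> i * (n - 1) ^ 3 + j * (n + 1) ^ 3"
proof (cases "even n")
  case True
  have "coprime (n - 1) (n + 1)"
  proof (rule coprimeI)
    fix d assume d: "d dvd n - 1" "d dvd n + 1"
    from dvd_diff[OF d(2,1)] have "d dvd 2" by simp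
    then have "d dvd n" using True by (rule dvd_trans)
    from dvd_diff[OF this d(1)] show "is_unit d" by simp
  qed
  then have "gcd ((n - 1) ^ 3) ((n + 1) ^ 3) = 1"
    by (simp add: coprime_iff_gcd_eq_1[symmetric])
  moreover have "n ^ 3 \<noteq> i * (n - 1) ^ 3 + j * (n + 1) ^ 3"
  proof
    assume eq: "n ^ 3 = i * (n - 1) ^ 3 + j * (n + 1) ^ 3"
    have "j < 1"
    proof (rule ccontr)
      assume "\<not> j < 1"
      then have "1 * (n + 1) ^ 3 \<le> j * (n + 1) ^ 3"
        using assms by (intro mult_right_mono) auto
      moreover have "n ^ 3 < (n + 1) ^ 3"
        using assms by (intro power_strict_mono) auto
      moreover have "0 \<le> i * (n - 1) ^ 3" using assms by simp
      ultimately show False using eq by linarith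
    qed
    then have "j = 0" using assms by simp
    then have "1 = (n - 1) * (i * (n - 1) ^ 2 - (n ^ 2 + n + 1))"
      using eq by (simp add: power2_eq_square power3_eq_cube algebra_simps)
    then have "n - 1 dvd 1" by (metis dvd_triv_left)
    then show False
      using assms by simp
  qed
  ultimately show ?thesis by simp
next
  case False
  then obtain m where m: "n = 2 * m + 1" by (elim oddE)
  have "coprime m (m + 1)"
    by simp
  then have "gcd (m ^ 3) ((m + 1) ^ 3) = 1"
    by (simp add: coprime_iff_gcd_eq_1[symmetric])
  moreover have pow: "(n - 1) ^ 3 = 8 * m ^ 3" "(n + 1) ^ 3 = 8 * (m + 1) ^ 3"
    unfolding m by (simp_all add: power3_eq_cube algebra_simps)
  ultimately have gcd: "gcd ((n - 1) ^ 3) ((n + 1) ^ 3) = 8"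
    using gcd_mult_distrib_int[of 8 "m ^ 3" "(m + 1) ^ 3"] by simp
  have "n ^ 3 \<noteq> i * m ^ 3 + j * (m + 1) ^ 3"
    unfolding m using assms m by (intro odd_cube_not_combination) auto
  then show ?thesis
    unfolding gcd unfolding pow by auto
qed

theorem proposition2:
  fixes n :: int
  assumes "n \<ge> 3"
  shows "symmetric_semigroup (semigroup3 ((n - 1) ^ 3) (n ^ 3) ((n + 1) ^ 3)) \<longleftrightarrow> n = 3"
proof
  assume "n = 3"
  then show "symmetric_semigroup (semigroup3 ((n - 1) ^ 3) (n ^ 3) ((n + 1) ^ 3))"
    using symmetric_semigroup3_8_27_64 by simp
next
  assume sym: "symmetric_semigroup (semigroup3 ((n - 1) ^ 3) (n ^ 3) ((n + 1) ^ 3))"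
  have "coprime (n - 1) n"
    using coprime_add_one_right[of "n - 1"] by simp
  then have gcd: "gcd ((n - 1) ^ 3) (n ^ 3) = 1"
    by (simp add: coprime_iff_gcd_eq_1[symmetric])
  have "coprime (n ^ 3) ((n + 1) ^ 3)"
    by simp
  moreover have "(n - 1) ^ 3 \<le> (n + 1) ^ 3"
    using assms by (intro power_mono) auto
  \<comment> \<open>For \<open>4 \<le> n\<close>, \<open>next_cube_not_combination\<close> excludes
    the first gluing alternative and \<open>middle_cube_not_combination\<close> the second.\<close>
  ultimately have "\<not> 4 \<le> n"
    using symmetric_semigroup3_imp_gluing[OF _ _ _ _ sym] assms gcd
      next_cube_not_combination middle_cube_not_combination by auto
  then show "n = 3" using assms by linarith
qed

end
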